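(* Let $\mathcal T$ be the completion of a tree built by grafting iteratively branches of lengths $a_1,a_2,\dots$, with no rule on where the branches are glued. If $\sum_{i=1}^\infty a_i<\infty$, then the tree $\mathcal T$ is compact and of Hausdorff dimension $1$. Moreover, $$\dim_{\mathrm H}(\mathsf{Leaves}(\mathcal T))\le\gamma\quad\text{as soon as}\quad\sum_{i=1}^\infty a_i^\gamma<\infty .$$
   Context: This is a deterministic statement. Let $(a_i)_{i\ge1}$ be a sequence of positive real numbers. $\mathcal T_1$ is a closed segment of length $a_1$; for each $n\ge1$, $\mathcal T_{n+1}$ is obtained from $\mathcal T_n$ by gluing one end of a closed segment ("branch") of length $a_{n+1}$ at an arbitrary point of $\mathcal T_n$. The trees are endowed with their length metric, and $\mathcal T$ is the completion of the increasing union $\bigcup_{n\ge1}\mathcal T_n$. A leaf of $\mathcal T$ is a point $x$ such that $\mathcal T\setminus\{x\}$ stays connected; $\mathsf{Leaves}(\mathcal T)$ is the set of leaves of $\mathcal T$, and $\dim_{\mathrm H}$ denotes Hausdorff dimension. *)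

theory Defs
  imports "HOL-Analysis.Analysis"
begin

section \<open>Trees obtained by grafting branches\<close>

text \<open>
  The pair \<open>(i, t)\<close> stands for the point at distance \<open>t\<close> from the glued end of the \<open>i\<close>-th branch.
  For \<open>i \<ge> 2\<close> the glued end itself, i.e. \<open>t = 0\<close>, is left out of branch \<open>i\<close>: it is identified with
  the point \<open>g (i - 1)\<close> of the tree built so far.  The value \<open>a 0\<close> is irrelevant.
\<close>

type_synonym tree_point = "nat \<times> real"

primrec tree :: "(nat \<Rightarrow> real) \<Rightarrow> nat \<Rightarrow> tree_point set" where
  "tree a 0 = {}"
| "tree a (Suc n) = tree a n \<union> {Suc n} \<times> (if n = 0 then {0..a 1} else {0<..a (Suc n)})"

definition grafting_points :: "(nat \<Rightarrow> real) \<Rightarrow> (nat \<Rightarrow> tree_point) \<Rightarrow> bool" where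
  "grafting_points a g \<longleftrightarrow> (\<forall>n\<ge>1. g n \<in> tree a n)"

text \<open>
  The length metric of the \<open>n\<close>-th tree: a path from the old tree to the point at height \<open>t\<close> on the
  new branch goes through the grafting point and then along the branch.  That this is indeed a length
  metric is lemma \<open>tree_dist_geodesic\<close> below.
\<close>

primrec tree_dist :: "(nat \<Rightarrow> tree_point) \<Rightarrow> nat \<Rightarrow> tree_point \<Rightarrow> tree_point \<Rightarrow> real" where
  "tree_dist g 0 x y = 0"
| "tree_dist g (Suc n) x y =
     (if fst x = Suc n \<and> fst y = Suc n then \<bar>snd x - snd y\<bar>
      else if fst x = Suc n then snd x + tree_dist g n (g n) y
      else if fst y = Suc n then tree_dist g n x (g n) + snd y
      else tree_dist g n x y)"

definition tree_union :: "(nat \<Rightarrow> real) \<Rightarrow> tree_point set" where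
  "tree_union a = (\<Union>n\<in>{1..}. tree a n)"

definition tree_union_dist :: "(nat \<Rightarrow> tree_point) \<Rightarrow> tree_point \<Rightarrow> tree_point \<Rightarrow> real" where
  "tree_union_dist g x y = tree_dist g (max (fst x) (fst y)) x y"

lemma tree_branch: "x \<in> tree a n \<Longrightarrow> 1 \<le> fst x \<and> fst x \<le> n \<and> 0 \<le> snd x"
  by (induction n) (auto split: if_splits)

lemma tree_mono: "m \<le> n \<Longrightarrow> tree a m \<subseteq> tree a n"
  by (induction n rule: nat_induct_at_least) auto

lemma tree_union_dist_eq:
  assumes "x \<in> tree a n" "y \<in> tree a n"
  shows "tree_union_dist g x y = tree_dist g n x y"
proof -
  define k where "k = max (fst x) (fst y)"
  have step: "tree_dist g m x y = tree_dist g k x y" if "k \<le> m" for m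
    using that
  proof (induction m rule: nat_induct_at_least)
    case (Suc m)
    then have "fst x \<noteq> Suc m" "fst y \<noteq> Suc m" by (auto simp: k_def)
    with Suc show ?case by simp
  qed simp
  have "k \<le> n"
    using tree_branch[OF assms(1)] tree_branch[OF assms(2)] by (simp add: k_def)
  then show ?thesis
    using step[of n] by (simp add: tree_union_dist_def k_def)
qed

lemma tree_dist_commute: "tree_dist g n x y = tree_dist g n y x"
proof (induction n arbitrary: x y)
  case (Suc n)
  show ?case
    using Suc.IH[of x y] Suc.IH[of x "g n"] Suc.IH[of "g n" y] by (simp add: abs_minus_commute)
qed simp

lemma tree_dist_refl: "tree_dist g n x x = 0"
  by (induction n) simp_all

context
  fixes a g
  assumes g: "grafting_points a g"
begin

lemma tree_Suc_cases:
  assumes "x \<in> tree a (Suc n)"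
  obtains "x \<in> tree a n" "fst x \<noteq> Suc n" "n \<ge> 1" "g n \<in> tree a n"
  | t where "x = (Suc n, t)" "0 \<le> t" "t \<le> a (Suc n)" "n = 0 \<or> 0 < t \<and> g n \<in> tree a n"
proof (cases "x \<in> tree a n")
  case True
  then have "n \<ge> 1" "fst x \<noteq> Suc n"
    using tree_branch[OF True] by simp_all
  with True g show ?thesis
    by (intro that(1)) (simp_all add: grafting_points_def)
next
  case False
  obtain i t where x: "x = (i, t)" by (cases x)
  have "n = 0 \<or> g n \<in> tree a n"
    using g by (cases "n = 0") (simp_all add: grafting_points_def)
  with False assms x show ?thesis
    by (intro that(2)[of t]) (simp_all split: if_splits)
qed

lemma tree_dist_nonneg:
  "x \<in> tree a n \<Longrightarrow> y \<in> tree a n \<Longrightarrow> 0 \<le> tree_dist g n x y"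
proof (induction n arbitrary: x y)
  case (Suc n)
  from Suc.prems(1) show ?case
  proof (cases rule: tree_Suc_cases)
    case x: 1
    from Suc.prems(2) show ?thesis
      by (cases rule: tree_Suc_cases) (use x Suc.IH[of x y] Suc.IH[of x "g n"] in simp_all)
  next
    case x: (2 s)
    from Suc.prems(2) show ?thesis
      by (cases rule: tree_Suc_cases) (use x Suc.IH[of "g n" y] in auto)
  qed
qed auto

lemma tree_dist_eq_0_iff:
  "x \<in> tree a n \<Longrightarrow> y \<in> tree a n \<Longrightarrow> tree_dist g n x y = 0 \<longleftrightarrow> x = y"
proof (induction n arbitrary: x y)
  case (Suc n)
  from Suc.prems(1) show ?case
  proof (cases rule: tree_Suc_cases)
    case x: 1
    from Suc.prems(2) show ?thesis
    proof (cases rule: tree_Suc_cases)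
      case 1
      with x Suc.IH show ?thesis by auto
    next
      case (2 t)
      with x tree_dist_nonneg[of x n "g n"] show ?thesis by auto
    qed
  next
    case x: (2 s)
    from Suc.prems(2) show ?thesis
    proof (cases rule: tree_Suc_cases)
      case 1
      with x tree_dist_nonneg[of "g n" n y] show ?thesis by auto
    next
      case (2 t)
      with x show ?thesis by auto
    qed
  qed
qed auto

lemma tree_dist_triangle:
  "x \<in> tree a n \<Longrightarrow> y \<in> tree a n \<Longrightarrow> z \<in> tree a n \<Longrightarrow>
    tree_dist g n x z \<le> tree_dist g n x y + tree_dist g n y z"
proof (induction n arbitrary: x y z)
  case (Suc n)
  note refl = tree_dist_refl[of g n "g n"] and comm = tree_dist_commute[of g n _ "g n"]
  have nn: "0 \<le> tree_dist g n (g n) u" if "u \<in> tree a n" "g n \<in> tree a n" for u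
    using that by (intro tree_dist_nonneg)
  from Suc.prems(1) show ?case
  proof (cases rule: tree_Suc_cases)
    case x: 1
    from Suc.prems(2) show ?thesis
    proof (cases rule: tree_Suc_cases)
      case y: 1
      from Suc.prems(3) show ?thesis
        by (cases rule: tree_Suc_cases) (use x y Suc.IH[of x y] in auto)
    next
      case y: (2 s)
      from Suc.prems(3) show ?thesis
        by (cases rule: tree_Suc_cases) (use x y Suc.IH[of x "g n" z] in auto)
    qed
  next
    case x: (2 r)
    from Suc.prems(2) show ?thesis
    proof (cases rule: tree_Suc_cases)
      case y: 1
      from Suc.prems(3) show ?thesis
        by (cases rule: tree_Suc_cases) (use x y Suc.IH[of "g n" y z] nn[of y] comm[of y] in auto)
    next
      case y: (2 s)
      from Suc.prems(3) show ?thesis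
        by (cases rule: tree_Suc_cases) (use x y in auto)
    qed
  qed
qed auto

lemma tree_dist_geodesic:
  assumes "x \<in> tree a n" "y \<in> tree a n"
  shows "\<exists>c. c 0 = x \<and> c (tree_dist g n x y) = y \<and>
    (\<forall>s\<in>{0..tree_dist g n x y}. c s \<in> tree a n \<and>
       (\<forall>t\<in>{0..tree_dist g n x y}. tree_dist g n (c s) (c t) = \<bar>s - t\<bar>))"
proof -
  define P where "P n x y \<longleftrightarrow> (\<exists>c. c 0 = x \<and> c (tree_dist g n x y) = y \<and>
    (\<forall>s\<in>{0..tree_dist g n x y}. c s \<in> tree a n \<and>
       (\<forall>t\<in>{0..tree_dist g n x y}. tree_dist g n (c s) (c t) = \<bar>s - t\<bar>)))" for n x y
  have sym: "P n y x" if P: "P n x y" for n x y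
  proof -
    let ?L = "tree_dist g n x y"
    have L: "tree_dist g n y x = ?L" by (rule tree_dist_commute)
    from P obtain c where c: "c 0 = x" "c ?L = y"
      "\<And>s. 0 \<le> s \<Longrightarrow> s \<le> ?L \<Longrightarrow> c s \<in> tree a n"
      "\<And>s t. \<lbrakk>0 \<le> s; s \<le> ?L; 0 \<le> t; t \<le> ?L\<rbrakk> \<Longrightarrow> tree_dist g n (c s) (c t) = \<bar>s - t\<bar>"
      unfolding P_def by (auto simp: Ball_def)
    show ?thesis
      unfolding P_def L by (rule exI[of _ "\<lambda>s. c (?L - s)"]) (auto simp: c)
  qed
  have branch: "P (Suc n) (Suc n, s) (Suc n, t)"
    if "(Suc n, s) \<in> tree a (Suc n)" "(Suc n, t) \<in> tree a (Suc n)" "s \<le> t" for n s t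
    unfolding P_def
  proof (rule exI[of _ "\<lambda>r. (Suc n, s + r)"], intro conjI ballI)
    fix r assume "r \<in> {0..tree_dist g (Suc n) (Suc n, s) (Suc n, t)}"
    with that show "(Suc n, s + r) \<in> tree a (Suc n)"
      using tree_branch[of "(Suc n, s)" a n] tree_branch[of "(Suc n, t)" a n]
      by (auto split: if_splits)
  qed (use that in auto)
  have mixed: "P (Suc n) x (Suc n, t)"
    if x: "x \<in> tree a n" and "P n x (g n)" "0 < t" "t \<le> a (Suc n)" "n \<ge> 1" for n x t
  proof -
    let ?L = "tree_dist g n x (g n)"
    from that obtain c where c: "c 0 = x" "c ?L = g n"
      "\<And>s. 0 \<le> s \<Longrightarrow> s \<le> ?L \<Longrightarrow> c s \<in> tree a n"
      "\<And>s t. \<lbrakk>0 \<le> s; s \<le> ?L; 0 \<le> t; t \<le> ?L\<rbrakk> \<Longrightarrow> tree_dist g n (c s) (c t) = \<bar>s - t\<bar>"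
      unfolding P_def by (auto simp: Ball_def)
    have gn: "g n \<in> tree a n" using g \<open>n \<ge> 1\<close> by (auto simp: grafting_points_def)
    have L0: "0 \<le> ?L" using x gn by (rule tree_dist_nonneg)
    have old: "fst u \<noteq> Suc n" if "u \<in> tree a n" for u
      using tree_branch[OF that] by simp
    have D: "tree_dist g (Suc n) x (Suc n, t) = ?L + t"
      using old[OF x] by simp
    have L1: "tree_dist g n (c s) (g n) = ?L - s" "tree_dist g n (g n) (c s) = ?L - s"
      if "0 \<le> s" "s \<le> ?L" for s
      using c(4)[of s ?L] c(4)[of ?L s] that by (auto simp: c(2))
    show ?thesis
      unfolding P_def D
      by (rule exI[of _ "\<lambda>s. if s \<le> ?L then c s else (Suc n, s - ?L)"])
         (use that L0 in \<open>auto simp: c L1 old[OF c(3)]\<close>)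
  qed
  have "P n x y"
    using assms
  proof (induction n arbitrary: x y)
    case (Suc n)
    have old: "P (Suc n) x y" if xy: "x \<in> tree a n" "y \<in> tree a n" for x y
    proof -
      have eq: "tree_dist g (Suc n) u v = tree_dist g n u v"
        if "u \<in> tree a n" "v \<in> tree a n" for u v
        using tree_branch[OF that(1)] tree_branch[OF that(2)] by auto
      from Suc.IH[OF xy] obtain c where "c 0 = x" "c (tree_dist g n x y) = y"
        "\<forall>s\<in>{0..tree_dist g n x y}. c s \<in> tree a n \<and>
          (\<forall>t\<in>{0..tree_dist g n x y}. tree_dist g n (c s) (c t) = \<bar>s - t\<bar>)"
        unfolding P_def by auto
      then show ?thesis
        unfolding P_def eq[OF xy] by (intro exI[of _ c]) (auto simp: eq simp del: tree_dist.simps)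
    qed
    from Suc.prems(1) show ?case
    proof (cases rule: tree_Suc_cases)
      case x: 1
      from Suc.prems(2) show ?thesis
      proof (cases rule: tree_Suc_cases)
        case 1
        with x show ?thesis by (intro old)
      next
        case (2 t)
        with x Suc.IH[of x "g n"] mixed[of x n t] show ?thesis by auto
      qed
    next
      case x: (2 s)
      from Suc.prems(2) show ?thesis
      proof (cases rule: tree_Suc_cases)
        case 1
        with x Suc.IH[of y "g n"] mixed[of y n s, THEN sym] show ?thesis by auto
      next
        case (2 t)
        have "P (Suc n) (Suc n, s) (Suc n, t)"
        proof (cases "s \<le> t")
          case True
          with branch Suc.prems 2 x show ?thesis by metis
        next
          case False
          then have "t \<le> s" by simp
          with branch[of n t s, THEN sym] Suc.prems 2 x show ?thesis by metis
        qed
        with 2 x show ?thesis by simp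
      qed
    qed
  qed auto
  then show ?thesis unfolding P_def .
qed

end


section \<open>Completions and leaves\<close>

text \<open>
  \<open>T\<close>, a subset of some metric space with the induced metric, is a completion of \<open>(S, d)\<close>
  with canonical map \<open>e\<close>.
\<close>

definition is_completion ::
  "'a set \<Rightarrow> ('a \<Rightarrow> 'a \<Rightarrow> real) \<Rightarrow> ('a \<Rightarrow> 'b::metric_space) \<Rightarrow> 'b set \<Rightarrow> bool" where
  "is_completion S d e T \<longleftrightarrow>
     (\<forall>x\<in>S. \<forall>y\<in>S. dist (e x) (e y) = d x y) \<and>
     complete T \<and> e ` S \<subseteq> T \<and> T \<subseteq> closure (e ` S)"

definition leaves :: "'b::topological_space set \<Rightarrow> 'b set" where
  "leaves T = {x \<in> T. connected (T - {x})}"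


section \<open>Hausdorff dimension\<close>

text \<open>
  Only exponents \<open>s > 0\<close> are used, so no convention about \<open>0\<^sup>0\<close> is needed.
  The library's \<open>diameter\<close> is meaningful on bounded sets only (and is \<open>0\<close> on the empty set).
\<close>

definition hausdorff_content :: "real \<Rightarrow> real \<Rightarrow> 'a::metric_space set \<Rightarrow> ennreal" where
  "hausdorff_content s \<delta> A =
     (INF U \<in> {U :: nat \<Rightarrow> 'a set. A \<subseteq> (\<Union>i. U i) \<and> (\<forall>i. bounded (U i) \<and> diameter (U i) \<le> \<delta>)}.
        \<Sum>i. ennreal (diameter (U i) powr s))"

definition hausdorff_measure :: "real \<Rightarrow> 'a::metric_space set \<Rightarrow> ennreal" where
  "hausdorff_measure s A = (SUP \<delta> \<in> {0<..}. hausdorff_content s \<delta> A)"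

definition hausdorff_dim :: "'a::metric_space set \<Rightarrow> ereal" where
  "hausdorff_dim A = (INF s \<in> {s. 0 < s \<and> hausdorff_measure s A = 0}. ereal s)"

end

theory Submission
  imports Defs
begin

text \<open>
  Fix a stage \<open>n\<close>.  Outside the \<open>n\<close>-th tree the union splits into bushes, one for each later branch that
  is glued directly on the \<open>n\<close>-th tree, and every later branch belongs to exactly one bush.  A path from a
  point of a bush to the place where the bush is attached uses each branch of the bush at most once.
  For \<open>0 < \<gamma> \<le> 1\<close> the map \<open>r \<mapsto> r powr \<gamma>\<close> is subadditive, so the \<open>\<gamma>\<close>-th power of the height of a bush
  is at most the sum of the \<open>\<gamma>\<close>-th powers of the lengths of its own branches
  (\<open>dist_stem_powr_le\<close>).  Consequently the \<open>n\<close>-th tree together with one ball for each bush covers the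
  completion (\<open>completion_subset\<close>), and the \<open>\<gamma>\<close>-th powers of the radii add up to at most the tail
  of \<open>\<Sum>i. a i powr \<gamma>\<close> after \<open>n\<close> (\<open>suminf_bush_weight\<close>).

  For \<open>\<gamma> = 1\<close> this shows that the finite trees, which are compact, are arbitrarily dense in \<open>T\<close>, so
  \<open>T\<close> is totally bounded and hence compact.  For general \<open>\<gamma> \<le> 1\<close> with a convergent series it shows
  that the points added by the completion, which lie in the balls for every \<open>n\<close>, form a set of zero
  \<open>\<gamma>\<close>-dimensional Hausdorff measure (\<open>hausdorff_null_new_points\<close>).

  The remaining points of \<open>T\<close> lie on countably many segments, which are null for every exponent above
  \<open>1\<close>, while a single segment is not null for the exponent \<open>1\<close>; so \<open>T\<close> has dimension \<open>1\<close>.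
  Finally, an inner point of a branch disconnects \<open>T\<close> (\<open>inner_branch_point_not_leaf\<close>), so a leaf is one
  of the countably many ends of branches or was added by the completion.  For \<open>\<gamma> > 1\<close> the bound on
  the dimension of the leaves is immediate from that of \<open>T\<close>.
\<close>

section \<open>Preliminaries on metric spaces and powers\<close>

lemma le_suminf_ennreal:
  fixes f :: "nat \<Rightarrow> ennreal"
  shows "f i \<le> (\<Sum>i. f i)"
  using sum_le_suminf[OF summableI, of "{i}" f] by simp

lemma powr_le_cancel:
  fixes x y s :: real
  assumes "0 < s" "0 \<le> y" "x powr s \<le> y powr s"
  shows "x \<le> y"
  using assms powr_less_mono2[of s y x] by (meson not_le)

lemma diameter_le_metric:
  fixes S :: "'a::metric_space set"
  assumes "0 \<le> d" "\<And>x y. x \<in> S \<Longrightarrow> y \<in> S \<Longrightarrow> dist x y \<le> d"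
  shows "diameter S \<le> d"
  using assms by (auto simp: diameter_def intro!: cSUP_least)

text \<open>
  The shares \<open>x / (x + y)\<close> and \<open>y / (x + y)\<close> add up to \<open>1\<close>, and raising a number in the unit
  interval to a power \<open>\<gamma> \<le> 1\<close> does not decrease it.
\<close>
lemma powr_add_le:
  fixes x y \<gamma> :: real
  assumes "0 \<le> x" "0 \<le> y" "0 < \<gamma>" "\<gamma> \<le> 1"
  shows "(x + y) powr \<gamma> \<le> x powr \<gamma> + y powr \<gamma>"
proof (cases "x + y = 0")
  case False
  with assms have S: "0 < x + y" by linarith
  have frac: "u / (x + y) \<le> u powr \<gamma> / (x + y) powr \<gamma>" if "0 \<le> u" "u \<le> x + y" for u
  proof -
    have "(u / (x + y)) powr 1 \<le> (u / (x + y)) powr \<gamma>"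
      using that S assms by (intro powr_mono') auto
    then show ?thesis using that S by (simp add: powr_divide)
  qed
  have "1 = x / (x + y) + y / (x + y)" using S by (simp flip: add_divide_distrib)
  also have "\<dots> \<le> x powr \<gamma> / (x + y) powr \<gamma> + y powr \<gamma> / (x + y) powr \<gamma>"
    using assms by (intro add_mono frac) auto
  finally show ?thesis using S by (simp add: field_simps)
qed (use assms in auto)

lemma closed_apart:
  fixes S :: "'a::metric_space set"
  assumes "closed S" "x \<notin> S"
  obtains \<delta> where "0 < \<delta>" "\<forall>y\<in>S. \<delta> \<le> dist x y"
proof -
  have "open (- S)" "x \<in> - S" using assms by auto
  then obtain \<delta> where "0 < \<delta>" "ball x \<delta> \<subseteq> - S" by (rule openE)
  then show ?thesis by (intro that[of \<delta>]) (force simp: not_less[symmetric])+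
qed

section \<open>Hausdorff null sets\<close>

text \<open>
  For null sets the mesh \<open>\<delta>\<close> takes care of itself: if the sum of the \<open>s\<close>-th powers of the
  diameters is small, then so is every single diameter.  Nullity can therefore be checked with
  covers of arbitrary mesh.
\<close>
lemma hausdorff_measure_eq_0_iff:
  fixes A :: "'a::metric_space set"
  assumes s: "0 < s"
  shows "hausdorff_measure s A = 0 \<longleftrightarrow>
    (\<forall>\<epsilon>>0. \<exists>U::nat \<Rightarrow> 'a set. A \<subseteq> (\<Union>i. U i) \<and> (\<forall>i. bounded (U i)) \<and>
      (\<Sum>i. ennreal (diameter (U i) powr s)) \<le> ennreal \<epsilon>)"
    (is "_ \<longleftrightarrow> (\<forall>\<epsilon>>0. \<exists>U. ?cover \<epsilon> U)")
proof (intro iffI allI impI)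
  fix \<epsilon> :: real assume H: "hausdorff_measure s A = 0" and \<epsilon>: "0 < \<epsilon>"
  have "hausdorff_content s 1 A \<le> hausdorff_measure s A"
    unfolding hausdorff_measure_def by (rule SUP_upper) simp
  then have "hausdorff_content s 1 A < ennreal \<epsilon>"
    using H \<epsilon> by simp
  then show "\<exists>U. ?cover \<epsilon> U"
    unfolding hausdorff_content_def INF_less_iff by (auto intro: less_imp_le)
next
  assume R: "\<forall>\<epsilon>>0. \<exists>U. ?cover \<epsilon> U"
  have content_le: "hausdorff_content s \<delta> A \<le> ennreal \<epsilon>" if \<delta>: "0 < \<delta>" and \<epsilon>: "0 < \<epsilon>" for \<delta> \<epsilon> :: real
  proof -
    \<comment> \<open>A total of at most \<open>\<delta> powr s\<close> forces every diameter to be at most \<open>\<delta>\<close>.\<close>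
    define \<eta> where "\<eta> = min \<epsilon> (\<delta> powr s)"
    have "0 < \<eta>" using \<delta> \<epsilon> by (simp add: \<eta>_def)
    then obtain U where U: "?cover \<eta> U" using R by blast
    have "diameter (U i) \<le> \<delta>" for i
    proof -
      have "ennreal (diameter (U i) powr s) \<le> (\<Sum>i. ennreal (diameter (U i) powr s))"
        by (rule le_suminf_ennreal)
      also have "\<dots> \<le> ennreal \<eta>" using U by simp
      finally have "diameter (U i) powr s \<le> \<delta> powr s"
        using \<open>0 < \<eta>\<close> by (simp add: \<eta>_def)
      then show ?thesis
        by (rule powr_le_cancel[OF s less_imp_le[OF \<delta>]])
    qed
    then have "hausdorff_content s \<delta> A \<le> (\<Sum>i. ennreal (diameter (U i) powr s))"
      unfolding hausdorff_content_def using U by (intro INF_lower) auto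
    also have "\<dots> \<le> ennreal \<epsilon>"
      by (rule order_trans[of _ "ennreal \<eta>"]) (use U in \<open>auto simp: \<eta>_def intro: ennreal_leI\<close>)
    finally show ?thesis .
  qed
  have "hausdorff_content s \<delta> A \<le> 0" if "0 < \<delta>" for \<delta> :: real
    by (rule ennreal_le_epsilon) (use content_le that in auto)
  then have "hausdorff_measure s A \<le> 0"
    unfolding hausdorff_measure_def by (intro SUP_least) auto
  then show "hausdorff_measure s A = 0" by simp
qed

lemma hausdorff_null_mono:
  assumes "0 < s" "hausdorff_measure s B = 0" "A \<subseteq> B"
  shows "hausdorff_measure s A = 0"
  using assms(2,3) unfolding hausdorff_measure_eq_0_iff[OF assms(1)] by (meson order_trans)

lemma hausdorff_null_exponent_mono:
  fixes A :: "'a::metric_space set"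
  assumes s: "0 < s" "s \<le> t" and null: "hausdorff_measure s A = 0"
  shows "hausdorff_measure t A = 0"
proof -
  have t: "0 < t" using s by simp
  show ?thesis
    unfolding hausdorff_measure_eq_0_iff[OF t]
  proof (intro allI impI)
    fix \<epsilon> :: real assume "0 < \<epsilon>"
    \<comment> \<open>A total of at most \<open>1\<close> forces all diameters to be at most \<open>1\<close>, where powers decrease in the exponent.\<close>
    then have "0 < min \<epsilon> 1" by simp
    then obtain U :: "nat \<Rightarrow> 'a set" where U: "A \<subseteq> (\<Union>i. U i)" "\<And>i. bounded (U i)"
      "(\<Sum>i. ennreal (diameter (U i) powr s)) \<le> ennreal (min \<epsilon> 1)"
      using null unfolding hausdorff_measure_eq_0_iff[OF s(1)] by blast
    have "diameter (U i) powr t \<le> diameter (U i) powr s" for i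
    proof -
      have "ennreal (diameter (U i) powr s) \<le> (\<Sum>i. ennreal (diameter (U i) powr s))"
        by (rule le_suminf_ennreal)
      also have "\<dots> \<le> ennreal 1" using U(3) by (rule order_trans) (simp add: ennreal_leI)
      finally have "diameter (U i) powr s \<le> 1 powr s" by simp
      then have "diameter (U i) \<le> 1"
        using s(1) by (rule powr_le_cancel[rotated 2]) auto
      with s diameter_ge_0[OF U(2)] show ?thesis by (intro powr_mono') auto
    qed
    then have "(\<Sum>i. ennreal (diameter (U i) powr t)) \<le> (\<Sum>i. ennreal (diameter (U i) powr s))"
      by (intro suminf_le summableI) (simp add: ennreal_leI)
    also have "\<dots> \<le> ennreal \<epsilon>"
      using U(3) by (rule order_trans) (simp add: ennreal_leI)
    finally show "\<exists>U. A \<subseteq> (\<Union>i. U i) \<and> (\<forall>i. bounded (U i)) \<and>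
      (\<Sum>i. ennreal (diameter (U i) powr t)) \<le> ennreal \<epsilon>"
      using U by blast
  qed
qed

lemma hausdorff_null_UN:
  fixes A :: "nat \<Rightarrow> 'a::metric_space set"
  assumes s: "0 < s" and null: "\<And>n. hausdorff_measure s (A n) = 0"
  shows "hausdorff_measure s (\<Union>n. A n) = 0"
  unfolding hausdorff_measure_eq_0_iff[OF s]
proof (intro allI impI)
  fix \<epsilon> :: real assume \<epsilon>: "0 < \<epsilon>"
  have "\<exists>U. A n \<subseteq> (\<Union>i. U i) \<and> (\<forall>i. bounded (U i)) \<and>
      (\<Sum>i. ennreal (diameter (U i) powr s)) \<le> ennreal (\<epsilon> * (1/2) ^ Suc n)" for n
    using null[of n] \<epsilon> unfolding hausdorff_measure_eq_0_iff[OF s] by simp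
  then obtain U where U: "\<And>n. A n \<subseteq> (\<Union>i. U n i)" "\<And>n i. bounded (U n i)"
    "\<And>n. (\<Sum>i. ennreal (diameter (U n i) powr s)) \<le> ennreal (\<epsilon> * (1/2) ^ Suc n)"
    by metis
  define V where "V = (\<lambda>p. case prod_decode p of (n, i) \<Rightarrow> U n i)"
  have "(\<Union>n. A n) \<subseteq> (\<Union>p. V p)"
  proof
    fix x assume "x \<in> (\<Union>n. A n)"
    then obtain n i where "x \<in> U n i" using U(1) by blast
    then have "x \<in> V (prod_encode (n, i))" by (simp add: V_def)
    then show "x \<in> (\<Union>p. V p)" by blast
  qed
  moreover have "bounded (V p)" for p
    using U(2) by (simp add: V_def split: prod.split)
  moreover have "(\<Sum>p. ennreal (diameter (V p) powr s)) \<le> ennreal \<epsilon>"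
  proof -
    have "(\<Sum>p. ennreal (diameter (V p) powr s)) =
        (\<Sum>p. (\<lambda>(n, i). ennreal (diameter (U n i) powr s)) (prod_decode p))"
      by (simp add: V_def case_prod_unfold)
    also have "\<dots> = (\<Sum>n. \<Sum>i. ennreal (diameter (U n i) powr s))"
      by (rule suminf_ennreal_2dimen) simp
    also have "\<dots> \<le> (\<Sum>n. ennreal (\<epsilon> * (1/2) ^ Suc n))"
      by (intro suminf_le summableI U(3))
    also have "\<dots> = ennreal \<epsilon>"
      using sums_mult[OF power_half_series, of \<epsilon>] \<epsilon> by (intro suminf_ennreal_eq) auto
    finally show ?thesis .
  qed
  ultimately show "\<exists>U. (\<Union>n. A n) \<subseteq> (\<Union>i. U i) \<and> (\<forall>i. bounded (U i)) \<and>
      (\<Sum>i. ennreal (diameter (U i) powr s)) \<le> ennreal \<epsilon>"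
    by blast
qed

lemma hausdorff_null_Un:
  assumes s: "0 < s" and "hausdorff_measure s A = 0" "hausdorff_measure s B = 0"
  shows "hausdorff_measure s (A \<union> B) = 0"
proof -
  have "A \<union> B = (\<Union>n::nat. if n = 0 then A else B)"
    by (auto split: if_splits)
  with assms show ?thesis
    using hausdorff_null_UN[OF s, of "\<lambda>n. if n = 0 then A else B"] by simp
qed

lemma hausdorff_null_countable:
  assumes s: "0 < s" and "countable A"
  shows "hausdorff_measure s A = 0"
proof (cases "A = {}")
  case False
  then obtain x :: "nat \<Rightarrow> 'a" where x: "A = range x"
    using assms(2) by (metis range_from_nat_into)
  show ?thesis
    unfolding hausdorff_measure_eq_0_iff[OF s]
    by (intro allI impI exI[of _ "\<lambda>i. {x i}"]) (auto simp: x)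
next
  case True
  show ?thesis
    unfolding hausdorff_measure_eq_0_iff[OF s]
    by (intro allI impI exI[of _ "\<lambda>i. {}"]) (auto simp: True)
qed

text \<open>
  Cutting the parameter interval into \<open>N\<close> equal parts costs \<open>N * (L / N) powr s\<close>, which tends to
  \<open>0\<close> because \<open>s > 1\<close>.
\<close>
lemma hausdorff_null_curve:
  fixes c :: "real \<Rightarrow> 'a::metric_space"
  assumes s: "1 < s" and L: "0 \<le> L"
    and c: "\<And>r t. r \<in> {0..L} \<Longrightarrow> t \<in> {0..L} \<Longrightarrow> dist (c r) (c t) \<le> \<bar>r - t\<bar>"
  shows "hausdorff_measure s (c ` {0..L}) = 0"
proof -
  have s0: "0 < s" using s by simp
  show ?thesis
    unfolding hausdorff_measure_eq_0_iff[OF s0]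
  proof (intro allI impI)
    fix \<epsilon> :: real assume \<epsilon>: "0 < \<epsilon>"
    have "((\<lambda>N. L powr s * real N powr (1 - s)) \<longlongrightarrow> L powr s * 0) sequentially"
      using s by (intro tendsto_intros tendsto_neg_powr filterlim_real_sequentially) auto
    then have "\<forall>\<^sub>F N in sequentially. L powr s * real N powr (1 - s) < \<epsilon>"
      using \<epsilon> by (intro order_tendstoD) auto
    then have "\<forall>\<^sub>F N in sequentially. L powr s * real N powr (1 - s) < \<epsilon> \<and> 0 < N"
      using eventually_gt_at_top[of "0::nat"] by eventually_elim auto
    then obtain N where N: "L powr s * real N powr (1 - s) < \<epsilon>" "0 < N"
      by (auto dest: eventually_happens)
    define I where "I k = {r \<in> {0..L}. real k * L / N \<le> r \<and> r \<le> (real k + 1) * L / N}" for k :: nat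
    define U where "U k = (if k < N then c ` I k else {})" for k
    have dist_U: "dist x y \<le> L / N" if "x \<in> c ` I k" "y \<in> c ` I k" for x y k
    proof -
      from that obtain r t where rt: "x = c r" "y = c t" "r \<in> I k" "t \<in> I k" by blast
      then have "r \<in> {0..L}" "t \<in> {0..L}" by (auto simp: I_def)
      then have "dist x y \<le> \<bar>r - t\<bar>" unfolding rt by (rule c)
      also have "\<bar>r - t\<bar> \<le> (real k + 1) * L / N - real k * L / N"
        using rt by (auto simp: I_def)
      also have "\<dots> = L / N" by (simp add: algebra_simps add_divide_distrib)
      finally show ?thesis .
    qed
    have diam: "diameter (c ` I k) powr s \<le> (L / N) powr s" for k
    proof (rule powr_mono2)
      show "diameter (c ` I k) \<le> L / N"
        using dist_U L by (intro diameter_le_metric) auto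
      show "0 \<le> diameter (c ` I k)"
        using dist_U by (intro diameter_ge_0) (auto simp: bounded_two_points intro!: exI[of _ "L / N"])
    qed (use s in auto)
    have "c ` {0..L} \<subseteq> (\<Union>k. U k)"
    proof (rule image_subsetI)
      fix r assume r: "r \<in> {0..L}"
      have "\<exists>k<N. r \<in> I k"
      proof (cases "r = L")
        case True
        have "real (N - 1) = real N - 1" using N by simp
        with True L N have "r \<in> I (N - 1)" by (auto simp: I_def field_simps)
        with N show ?thesis by (intro exI[of _ "N - 1"]) auto
      next
        case False
        \<comment> \<open>The index of the part that contains \<open>r\<close>; for \<open>r = L\<close> this formula would give \<open>N\<close>.\<close>
        define k where "k = nat \<lfloor>r * N / L\<rfloor>"
        from False r have "0 < L" "r < L" by auto
        have "0 \<le> r * N / L" using r L by auto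
        then have k: "real k \<le> r * N / L" "r * N / L < real k + 1"
          unfolding k_def by linarith+
        have "r * N / L < N" using \<open>r < L\<close> \<open>0 < L\<close> N by (simp add: field_simps)
        with k have "k < N" by linarith
        moreover have "r \<in> I k"
          using k r \<open>0 < L\<close> N by (auto simp: I_def field_simps)
        ultimately show ?thesis by blast
      qed
      then show "c r \<in> (\<Union>k. U k)" by (auto simp: U_def)
    qed
    moreover have "bounded (U k)" for k
      using dist_U by (auto simp: U_def bounded_two_points intro!: exI[of _ "L / N"])
    moreover have "(\<Sum>k. ennreal (diameter (U k) powr s)) \<le> ennreal \<epsilon>"
    proof -
      have "(\<Sum>k. ennreal (diameter (U k) powr s)) = (\<Sum>k<N. ennreal (diameter (U k) powr s))"
        by (rule suminf_finite) (auto simp: U_def)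
      also have "\<dots> \<le> (\<Sum>k<N. ennreal ((L / N) powr s))"
        using diam by (intro sum_mono) (auto simp: U_def intro: ennreal_leI)
      also have "\<dots> = ennreal (N * (L / N) powr s)"
        by (simp add: ennreal_mult ennreal_of_nat_eq_real_of_nat)
      also have "N * (L / N) powr s = L powr s * real N powr (1 - s)"
        using N L by (simp add: powr_divide powr_diff)
      also have "ennreal \<dots> \<le> ennreal \<epsilon>" using N by (simp add: ennreal_leI)
      finally show ?thesis .
    qed
    ultimately show "\<exists>U. c ` {0..L} \<subseteq> (\<Union>i. U i) \<and> (\<forall>i. bounded (U i)) \<and>
      (\<Sum>i. ennreal (diameter (U i) powr s)) \<le> ennreal \<epsilon>"
      by blast
  qed
qed

text \<open>
  A cover of an isometric copy of \<open>{0..L}\<close> pulls back to a cover of \<open>{0..L}\<close>, and Lebesgue measure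
  bounds the sum of the diameters from below.
\<close>
lemma hausdorff_segment_not_null:
  fixes c :: "real \<Rightarrow> 'a::metric_space"
  assumes L: "0 < L"
    and c: "\<And>r t. r \<in> {0..L} \<Longrightarrow> t \<in> {0..L} \<Longrightarrow> dist (c r) (c t) = \<bar>r - t\<bar>"
  shows "hausdorff_measure 1 (c ` {0..L}) \<noteq> 0"
proof
  assume "hausdorff_measure 1 (c ` {0..L}) = 0"
  \<comment> \<open>A set of diameter \<open>d\<close> pulls back into an interval of length \<open>2 * d\<close>, so any total below \<open>L / 2\<close> is absurd.\<close>
  then obtain U where U: "c ` {0..L} \<subseteq> (\<Union>i. U i)" "\<And>i. bounded (U i)"
    "(\<Sum>i. ennreal (diameter (U i) powr 1)) \<le> ennreal (L / 4)"
    using L unfolding hausdorff_measure_eq_0_iff[OF zero_less_one]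
    by (meson zero_less_divide_iff zero_less_numeral)
  have d0: "0 \<le> diameter (U i)" for i by (rule diameter_ge_0[OF U(2)])
  define V where "V i = {r \<in> {0..L}. c r \<in> U i}" for i
  have "\<exists>r. V i \<subseteq> cball r (diameter (U i))" for i
  proof (cases "V i = {}")
    case False
    then obtain r where r: "r \<in> V i" by blast
    have "V i \<subseteq> cball r (diameter (U i))"
    proof
      fix t assume t: "t \<in> V i"
      then have "dist (c r) (c t) \<le> diameter (U i)"
        using r by (intro diameter_bounded_bound U(2)) (auto simp: V_def)
      with r t show "t \<in> cball r (diameter (U i))" by (simp add: V_def c dist_real_def)
    qed
    then show ?thesis ..
  qed auto
  then obtain r where r: "\<And>i. V i \<subseteq> cball (r i) (diameter (U i))" by metis
  have "ennreal L = emeasure lborel {0..L}" using L by simp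
  also have "\<dots> \<le> emeasure lborel (\<Union>i. cball (r i) (diameter (U i)))"
  proof (rule emeasure_mono)
    show "{0..L} \<subseteq> (\<Union>i. cball (r i) (diameter (U i)))"
    proof
      fix t assume t: "t \<in> {0..L}"
      then obtain i where "c t \<in> U i" using U(1) by blast
      with t have "t \<in> V i" by (simp add: V_def)
      with r show "t \<in> (\<Union>i. cball (r i) (diameter (U i)))" by blast
    qed
  qed simp
  also have "\<dots> \<le> (\<Sum>i. emeasure lborel (cball (r i) (diameter (U i))))"
    by (rule emeasure_subadditive_countably) auto
  also have "\<dots> = (\<Sum>i. 2 * ennreal (diameter (U i) powr 1))"
    using d0 by (simp add: cball_eq_atLeastAtMost ennreal_mult' powr_one[OF d0])
  also have "\<dots> = 2 * (\<Sum>i. ennreal (diameter (U i) powr 1))"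
    by (rule ennreal_suminf_cmult)
  also have "\<dots> \<le> 2 * ennreal (L / 4)" by (intro mult_left_mono U(3)) simp
  also have "\<dots> = ennreal (L / 2)" using L by (simp flip: ennreal_numeral ennreal_mult')
  finally show False using L by simp
qed

lemma hausdorff_dim_le:
  assumes "0 < s" "hausdorff_measure s A = 0"
  shows "hausdorff_dim A \<le> ereal s"
  unfolding hausdorff_dim_def using assms by (intro INF_lower) simp

lemma hausdorff_dim_mono:
  assumes "A \<subseteq> B"
  shows "hausdorff_dim A \<le> hausdorff_dim B"
  unfolding hausdorff_dim_def
  using hausdorff_null_mono[OF _ _ assms] by (intro INF_superset_mono) auto

section \<open>Finite stages of a grafted tree\<close>

lemma mem_tree_iff:
  "(j, t) \<in> tree a n \<longleftrightarrow> 1 \<le> j \<and> j \<le> n \<and> t \<le> a j \<and> (if j = 1 then 0 \<le> t else 0 < t)"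
  by (induction n) (auto simp: le_Suc_eq)

lemma mem_tree_le: "x \<in> tree a m \<Longrightarrow> fst x \<le> n \<Longrightarrow> x \<in> tree a n"
  by (cases x) (auto simp: mem_tree_iff)

locale grafted_tree =
  fixes a :: "nat \<Rightarrow> real"
    and g :: "nat \<Rightarrow> tree_point"
    and e :: "tree_point \<Rightarrow> 'b::metric_space"
    and T :: "'b set"
  assumes pos: "\<And>i. i \<ge> 1 \<Longrightarrow> 0 < a i"
    and grafting: "grafting_points a g"
    and completion: "is_completion (tree_union a) (tree_union_dist g) e T"
begin

lemma tree_subset_union: "tree a n \<subseteq> tree_union a"
  by (cases "n = 0") (auto simp: tree_union_def)

lemma image_tree_subset: "e ` tree a n \<subseteq> T"
  using completion tree_subset_union unfolding is_completion_def by blast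

lemma dist_e:
  assumes "x \<in> tree a n" "y \<in> tree a n"
  shows "dist (e x) (e y) = tree_dist g n x y"
proof -
  have "dist (e x) (e y) = tree_union_dist g x y"
    using completion assms tree_subset_union unfolding is_completion_def by blast
  then show ?thesis using tree_union_dist_eq[OF assms] by simp
qed

lemma dist_same_branch:
  assumes "(j, s) \<in> tree a n" "(j, t) \<in> tree a n"
  shows "dist (e (j, s)) (e (j, t)) = \<bar>s - t\<bar>"
proof -
  have "(j, s) \<in> tree a j" "(j, t) \<in> tree a j" "1 \<le> j"
    using assms by (auto simp: mem_tree_iff)
  then show ?thesis by (cases j) (simp_all add: dist_e[of _ j])
qed

lemma grafting_point:
  assumes "2 \<le> j"
  shows "g (j - 1) \<in> tree a (j - 1)" "fst (g (j - 1)) < j"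
proof -
  show gj: "g (j - 1) \<in> tree a (j - 1)" using grafting assms by (simp add: grafting_points_def)
  from tree_branch[OF gj] assms show "fst (g (j - 1)) < j" by auto
qed

lemma dist_grafting_point:
  assumes "2 \<le> j" "(j, t) \<in> tree a n"
  shows "dist (e (j, t)) (e (g (j - 1))) = t"
proof -
  obtain k where j: "j = Suc k" using assms(1) by (cases j) auto
  have "(j, t) \<in> tree a j" using assms by (auto simp: mem_tree_iff)
  moreover have "g k \<in> tree a j" using grafting_point(1)[OF assms(1)] tree_mono[of k j] j by auto
  moreover have "fst (g k) \<noteq> Suc k" using grafting_point(2)[OF assms(1)] j by simp
  ultimately show ?thesis by (simp add: dist_e[of _ j] j tree_dist_refl)
qed

text \<open>
  The closed branch \<open>j\<close> parametrised by height.  The pairs \<open>(j, 0)\<close> with \<open>j \<ge> 2\<close> are not points of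
  the tree, so height \<open>0\<close> must be sent to the grafting point; this makes branches isometric copies
  of compact intervals.
\<close>
definition branch :: "nat \<Rightarrow> real \<Rightarrow> 'b" where
  "branch j t = (if 2 \<le> j \<and> t = 0 then e (g (j - 1)) else e (j, t))"

lemma dist_branch:
  assumes "1 \<le> j" "s \<in> {0..a j}" "t \<in> {0..a j}"
  shows "dist (branch j s) (branch j t) = \<bar>s - t\<bar>"
  using assms dist_same_branch[of j s j t] dist_grafting_point[of j s j] dist_grafting_point[of j t j]
  by (auto simp: branch_def mem_tree_iff dist_commute split: if_splits)

lemma image_tree_eq: "e ` tree a n = (\<Union>j\<in>{1..n}. branch j ` {0..a j})"
proof (intro equalityI subsetI)
  fix x assume "x \<in> e ` tree a n"
  then obtain j t where "x = e (j, t)" "(j, t) \<in> tree a n" by auto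
  then have "1 \<le> j" "j \<le> n" "t \<in> {0..a j}" "x = branch j t"
    by (auto simp: mem_tree_iff branch_def split: if_splits)
  then show "x \<in> (\<Union>j\<in>{1..n}. branch j ` {0..a j})"
    by (intro UN_I[of j]) auto
next
  fix x assume "x \<in> (\<Union>j\<in>{1..n}. branch j ` {0..a j})"
  then obtain j t where jt: "1 \<le> j" "j \<le> n" "0 \<le> t" "t \<le> a j" "x = branch j t" by auto
  show "x \<in> e ` tree a n"
  proof (cases "2 \<le> j \<and> t = 0")
    case True
    then have "g (j - 1) \<in> tree a n"
      using mem_tree_le[OF grafting_point(1)[of j], of n] grafting_point(2)[of j] jt by simp
    with True jt show ?thesis by (simp add: branch_def)
  next
    case False
    with jt have "(j, t) \<in> tree a n" by (auto simp: mem_tree_iff)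
    with False jt show ?thesis by (auto simp: branch_def)
  qed
qed

lemma continuous_on_branch: "1 \<le> j \<Longrightarrow> continuous_on {0..a j} (branch j)"
  unfolding continuous_on_iff by (metis dist_branch dist_real_def)

lemma compact_image_tree: "compact (e ` tree a n)"
  unfolding image_tree_eq
  by (intro compact_UN compact_continuous_image continuous_on_branch) auto

end

section \<open>Components outside a finite stage\<close>

text \<open>
  For \<open>j > n\<close> the component of the complement of the \<open>n\<close>-th tree that contains branch \<open>j\<close> is
  named by its first branch: the stem of \<open>j\<close> is reached by passing from a branch to the branch it is
  glued on, as long as that one still has index above \<open>n\<close>.  The bound \<open>fst (g (j - 1)) < j\<close> holds
  along any admissible grafting once \<open>j \<ge> 2\<close>; it makes the recursion terminate for all \<open>g\<close>.
\<close>
fun stem :: "(nat \<Rightarrow> tree_point) \<Rightarrow> nat \<Rightarrow> nat \<Rightarrow> nat" where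
  "stem g n j = (if n < fst (g (j - 1)) \<and> fst (g (j - 1)) < j then stem g n (fst (g (j - 1))) else j)"

declare stem.simps [simp del]

context grafted_tree
begin

lemma stem_less:
  assumes "1 \<le> n" "n < j"
  shows "n < stem g n j \<and> g (stem g n j - 1) \<in> tree a n"
  using assms(2)
proof (induction j rule: less_induct)
  case (less j)
  define p where "p = fst (g (j - 1))"
  have j: "2 \<le> j" using assms less.prems by simp
  have "p < j" using grafting_point(2)[OF j] by (simp add: p_def)
  show ?case
  proof (cases "n < p")
    case True
    then have "stem g n j = stem g n p" using \<open>p < j\<close> by (subst stem.simps) (simp add: p_def)
    with less.IH[OF \<open>p < j\<close> True] show ?thesis by simp
  next
    case False
    then have "stem g n j = j" by (subst stem.simps) (simp add: p_def)
    with False less.prems show ?thesis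
      using mem_tree_le[OF grafting_point(1)[OF j], of n] by (simp add: p_def)
  qed
qed

text \<open>
  The key estimate.  The path from a point on branch \<open>j\<close> down to the point where its component is
  attached passes at most once through each branch of the component, along a piece no longer than
  that branch; subadditivity of the \<open>\<gamma>\<close>-th power turns the sum of lengths into a sum of
  \<open>\<gamma>\<close>-th powers.
\<close>
lemma dist_stem_powr_le:
  assumes n: "1 \<le> n" and \<gamma>: "0 < \<gamma>" "\<gamma> \<le> 1"
    and "n < j" "(j, t) \<in> tree a j"
  shows "dist (e (j, t)) (e (g (stem g n j - 1))) powr \<gamma> \<le>
    (\<Sum>k | n < k \<and> k \<le> j \<and> stem g n k = stem g n j. a k powr \<gamma>)"
  using assms(4,5)
proof (induction j arbitrary: t rule: less_induct)
  case (less j)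
  define p where "p = fst (g (j - 1))"
  define h where "h = snd (g (j - 1))"
  let ?i = "stem g n j"
  let ?C = "\<lambda>j. {k. n < k \<and> k \<le> j \<and> stem g n k = ?i}"
  have j: "2 \<le> j" using n less.prems by simp
  have "p < j" using grafting_point(2)[OF j] by (simp add: p_def)
  have t: "0 \<le> t" "t \<le> a j" using less.prems by (auto simp: mem_tree_iff split: if_splits)
  have d: "dist (e (j, t)) (e (g (j - 1))) = t" by (rule dist_grafting_point[OF j less.prems(2)])
  have tj: "t powr \<gamma> \<le> a j powr \<gamma>" using t \<gamma> by (intro powr_mono2) auto
  have fin: "finite (?C j)" by (rule finite_subset[of _ "{..j}"]) auto
  show ?case
  proof (cases "n < p")
    case True
    then have i: "?i = stem g n p" using \<open>p < j\<close> by (subst stem.simps) (simp add: p_def)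
    have g: "g (j - 1) = (p, h)" by (simp add: p_def h_def)
    have "(p, h) \<in> tree a p"
      using mem_tree_le[OF grafting_point(1)[OF j], of p] by (simp add: p_def h_def)
    then have IH: "dist (e (g (j - 1))) (e (g (?i - 1))) powr \<gamma> \<le> (\<Sum>k\<in>?C p. a k powr \<gamma>)"
      using less.IH[OF \<open>p < j\<close> True, of h] by (simp only: i g)
    have "dist (e (j, t)) (e (g (?i - 1))) powr \<gamma> \<le> (t + dist (e (g (j - 1))) (e (g (?i - 1)))) powr \<gamma>"
      using dist_triangle[of "e (j, t)" "e (g (?i - 1))" "e (g (j - 1))"] \<gamma>
      by (intro powr_mono2) (auto simp del: One_nat_def simp: d)
    also have "\<dots> \<le> t powr \<gamma> + dist (e (g (j - 1))) (e (g (?i - 1))) powr \<gamma>"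
      using t \<gamma> by (intro powr_add_le) auto
    also have "\<dots> \<le> a j powr \<gamma> + (\<Sum>k\<in>?C p. a k powr \<gamma>)"
      by (intro add_mono tj IH)
    also have "\<dots> = (\<Sum>k\<in>insert j (?C p). a k powr \<gamma>)"
      using \<open>p < j\<close> finite_subset[OF _ fin, of "?C p"] by (subst sum.insert) auto
    also have "\<dots> \<le> (\<Sum>k\<in>?C j. a k powr \<gamma>)"
      using fin less.prems \<open>p < j\<close> by (intro sum_mono2) auto
    finally show ?thesis .
  next
    case False
    then have i: "?i = j" by (subst stem.simps) (simp add: p_def)
    have "dist (e (j, t)) (e (g (?i - 1))) powr \<gamma> \<le> (\<Sum>k\<in>{j}. a k powr \<gamma>)"
      using tj by (simp only: i d) simp
    also have "\<dots> \<le> (\<Sum>k\<in>?C j. a k powr \<gamma>)"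
      using fin less.prems by (intro sum_mono2) auto
    finally show ?thesis .
  qed
qed

text \<open>
  The bush with stem \<open>i\<close> consists of the branches of index above \<open>n\<close> whose stem is \<open>i\<close>, and its weight is the
  sum of the \<open>\<gamma>\<close>-th powers of their lengths.  Indices \<open>i\<close> that are not stems get weight \<open>0\<close>, so
  that sums can run over all \<open>i\<close>.
\<close>
definition bush_summand :: "real \<Rightarrow> nat \<Rightarrow> nat \<Rightarrow> nat \<Rightarrow> real" where
  "bush_summand \<gamma> n i k = (if n < k \<and> stem g n k = i then a k powr \<gamma> else 0)"

definition bush_weight :: "real \<Rightarrow> nat \<Rightarrow> nat \<Rightarrow> real" where
  "bush_weight \<gamma> n i = (\<Sum>k. bush_summand \<gamma> n i k)"

context
  fixes \<gamma> :: real and n :: nat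
  assumes \<gamma>: "0 < \<gamma>" "\<gamma> \<le> 1" and summable_powr: "summable (\<lambda>i. a (Suc i) powr \<gamma>)"
    and n: "1 \<le> n"
begin

lemma sums_tail:
  "(\<lambda>k. if n < k then a k powr \<gamma> else 0) sums (\<Sum>k. a (Suc (k + n)) powr \<gamma>)"
proof -
  have "summable (\<lambda>k. a (Suc (k + n)) powr \<gamma>)"
    using summable_ignore_initial_segment[OF summable_powr, of n] by simp
  then have "(\<lambda>k. a (Suc (k + n)) powr \<gamma>) sums (\<Sum>k. a (Suc (k + n)) powr \<gamma>)"
    by (rule summable_sums)
  then show ?thesis
    using sums_iff_shift[of "\<lambda>k. if n < k then a k powr \<gamma> else 0" "Suc n"] by simp
qed

lemma summable_bush_summand: "summable (bush_summand \<gamma> n i)"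
  by (rule summable_comparison_test'[OF sums_summable[OF sums_tail], of 0])
     (simp add: bush_summand_def)

lemma bush_weight_nonneg: "0 \<le> bush_weight \<gamma> n i"
  unfolding bush_weight_def by (rule suminf_nonneg[OF summable_bush_summand]) (simp add: bush_summand_def)

text \<open>
  Every branch of index above \<open>n\<close> belongs to exactly one bush, so interchanging the two sums leaves one term
  for each such branch.
\<close>
lemma suminf_bush_weight: "(\<Sum>i. ennreal (bush_weight \<gamma> n i)) = ennreal (\<Sum>k. a (Suc (k + n)) powr \<gamma>)"
proof -
  have "(\<Sum>i. ennreal (bush_weight \<gamma> n i)) = (\<Sum>i. \<Sum>k. ennreal (bush_summand \<gamma> n i k))"
    unfolding bush_weight_def
    by (intro suminf_cong suminf_ennreal2[symmetric] summable_bush_summand) (simp add: bush_summand_def)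
  also have "\<dots> = (\<Sum>i. \<integral>\<^sup>+ k. ennreal (bush_summand \<gamma> n i k) \<partial>count_space UNIV)"
    by (simp add: nn_integral_count_space_nat)
  also have "\<dots> = (\<integral>\<^sup>+ k. (\<Sum>i. ennreal (bush_summand \<gamma> n i k)) \<partial>count_space UNIV)"
    by (rule nn_integral_suminf[symmetric]) simp
  also have "\<dots> = (\<Sum>k. \<Sum>i. ennreal (bush_summand \<gamma> n i k))"
    by (simp add: nn_integral_count_space_nat)
  also have "\<dots> = (\<Sum>k. ennreal (if n < k then a k powr \<gamma> else 0))"
  proof (rule suminf_cong)
    fix k
    have "(\<Sum>i. ennreal (bush_summand \<gamma> n i k)) = (\<Sum>i\<in>{stem g n k}. ennreal (bush_summand \<gamma> n i k))"
      by (rule suminf_finite) (auto simp: bush_summand_def)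
    then show "(\<Sum>i. ennreal (bush_summand \<gamma> n i k)) = ennreal (if n < k then a k powr \<gamma> else 0)"
      by (simp add: bush_summand_def)
  qed
  also have "\<dots> = ennreal (\<Sum>k. a (Suc (k + n)) powr \<gamma>)"
    using sums_tail by (intro suminf_ennreal_eq) auto
  finally show ?thesis .
qed

lemma summable_bush_weight: "summable (bush_weight \<gamma> n)"
  by (rule summable_suminf_not_top) (simp_all add: bush_weight_nonneg suminf_bush_weight)

lemma bush_weight_le_tail: "bush_weight \<gamma> n i \<le> (\<Sum>k. a (Suc (k + n)) powr \<gamma>)"
proof -
  have "(\<Sum>k. bush_summand \<gamma> n i k) \<le> (\<Sum>k. if n < k then a k powr \<gamma> else 0)"
    by (intro suminf_le summable_bush_summand sums_summable[OF sums_tail]) (simp add: bush_summand_def)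
  then show ?thesis by (simp add: bush_weight_def sums_unique[OF sums_tail])
qed

lemma image_union_subset:
  "e ` tree_union a \<subseteq> e ` tree a n \<union>
     (\<Union>i\<in>{i. g (i - 1) \<in> tree a n}. cball (e (g (i - 1))) (bush_weight \<gamma> n i powr (1 / \<gamma>)))"
proof (rule image_subsetI)
  fix x assume "x \<in> tree_union a"
  then obtain j t m where x: "x = (j, t)" "(j, t) \<in> tree a m"
    by (cases x) (auto simp: tree_union_def)
  show "e x \<in> e ` tree a n \<union>
     (\<Union>i\<in>{i. g (i - 1) \<in> tree a n}. cball (e (g (i - 1))) (bush_weight \<gamma> n i powr (1 / \<gamma>)))"
  proof (cases "n < j")
    case True
    let ?i = "stem g n j"
    let ?C = "{k. n < k \<and> k \<le> j \<and> stem g n k = ?i}"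
    have fin: "finite ?C" by (rule finite_subset[of _ "{..j}"]) auto
    have "(j, t) \<in> tree a j" using x(2) by (auto simp: mem_tree_iff)
    then have "dist (e x) (e (g (?i - 1))) powr \<gamma> \<le> (\<Sum>k\<in>?C. a k powr \<gamma>)"
      using dist_stem_powr_le[OF n \<gamma> True] x by simp
    also have "\<dots> = (\<Sum>k\<in>?C. bush_summand \<gamma> n ?i k)"
      by (rule sum.cong) (auto simp: bush_summand_def)
    also have "\<dots> \<le> bush_weight \<gamma> n ?i"
      unfolding bush_weight_def by (rule sum_le_suminf[OF summable_bush_summand fin]) (simp add: bush_summand_def)
    finally have "(dist (e x) (e (g (?i - 1))) powr \<gamma>) powr (1 / \<gamma>) \<le> bush_weight \<gamma> n ?i powr (1 / \<gamma>)"
      using \<gamma> by (intro powr_mono2) auto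
    then have "dist (e x) (e (g (?i - 1))) \<le> bush_weight \<gamma> n ?i powr (1 / \<gamma>)"
      using \<gamma> by (simp add: powr_powr)
    then have "e x \<in> cball (e (g (?i - 1))) (bush_weight \<gamma> n ?i powr (1 / \<gamma>))"
      by (simp add: dist_commute)
    with stem_less[OF n True] show ?thesis by blast
  next
    case False
    with x mem_tree_le[of "(j, t)" a m n] show ?thesis by auto
  qed
qed

text \<open>
  The balls around the attachment points of the bushes still cover after passing to the completion,
  although there may be infinitely many of them: a point at distance \<open>\<delta>\<close> from the closed \<open>n\<close>-th tree
  cannot be approached through balls of radius below \<open>\<delta> / 2\<close> centred on that tree, and only
  finitely many balls are larger.
\<close>
lemma completion_subset:
  "T \<subseteq> e ` tree a n \<union>
     (\<Union>i\<in>{i. g (i - 1) \<in> tree a n}. cball (e (g (i - 1))) (bush_weight \<gamma> n i powr (1 / \<gamma>)))"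
proof (rule subsetI, rule ccontr)
  define B where "B i = cball (e (g (i - 1))) (bush_weight \<gamma> n i powr (1 / \<gamma>))" for i
  define I where "I = {i. g (i - 1) \<in> tree a n}"
  fix x assume x: "x \<in> T" and "x \<notin> e ` tree a n \<union>
     (\<Union>i\<in>{i. g (i - 1) \<in> tree a n}. cball (e (g (i - 1))) (bush_weight \<gamma> n i powr (1 / \<gamma>)))"
  then have notin: "x \<notin> e ` tree a n" "\<And>i. i \<in> I \<Longrightarrow> x \<notin> B i"
    by (auto simp: B_def I_def)
  have closed: "closed (e ` tree a n)" by (intro compact_imp_closed compact_image_tree)
  obtain \<delta> where \<delta>: "0 < \<delta>" "\<forall>y\<in>e ` tree a n. \<delta> \<le> dist x y"
    using closed notin(1) by (rule closed_apart)
  have "(\<lambda>i. bush_weight \<gamma> n i powr (1 / \<gamma>)) \<longlonglongrightarrow> 0 powr (1 / \<gamma>)"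
    using \<gamma> bush_weight_nonneg
    by (intro tendsto_powr' summable_LIMSEQ_zero[OF summable_bush_weight] tendsto_const) auto
  then have "\<forall>\<^sub>F i in sequentially. bush_weight \<gamma> n i powr (1 / \<gamma>) < \<delta> / 2"
    by (rule order_tendstoD(2)) (use \<delta>(1) in simp)
  then obtain N where N: "\<And>i. N \<le> i \<Longrightarrow> bush_weight \<gamma> n i powr (1 / \<gamma>) < \<delta> / 2"
    by (auto simp: eventually_sequentially)
  define K where "K = (\<Union>i\<in>{i\<in>I. i < N}. B i)"
  have "closed K" unfolding K_def by (intro closed_UN) (auto simp: B_def)
  moreover have "x \<notin> K" using notin by (auto simp: K_def)
  ultimately obtain \<epsilon> where \<epsilon>: "0 < \<epsilon>" "\<forall>y\<in>K. \<epsilon> \<le> dist x y"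
    by (rule closed_apart)
  have "x \<in> closure (e ` tree_union a)" using completion x by (auto simp: is_completion_def)
  moreover have "0 < min \<epsilon> (\<delta> / 2)" using \<epsilon> \<delta> by simp
  ultimately obtain y where y: "y \<in> e ` tree_union a" "dist y x < min \<epsilon> (\<delta> / 2)"
    unfolding closure_approachable by blast
  \<comment> \<open>Points this close to \<open>x\<close> avoid the finite stage and the finitely many large balls.\<close>
  have "y \<notin> e ` tree a n" using y \<delta> by (force simp: dist_commute)
  then obtain i where i: "i \<in> I" "y \<in> B i"
    using y(1) image_union_subset by (auto simp: I_def B_def)
  have "y \<notin> K" using y \<epsilon> by (force simp: dist_commute)
  have "N \<le> i"
    by (rule ccontr) (use i \<open>y \<notin> K\<close> in \<open>auto simp: K_def\<close>)
  have "\<delta> \<le> dist x (e (g (i - 1)))" using i \<delta>(2) by (auto simp: I_def)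
  also have "\<dots> \<le> dist y x + dist (e (g (i - 1))) y"
    using dist_triangle[of x "e (g (i - 1))" y] by (simp add: dist_commute)
  also have "\<dots> < \<delta> / 2 + \<delta> / 2"
    using y i N[OF \<open>N \<le> i\<close>] by (intro add_strict_mono) (auto simp: B_def)
  finally show False by simp
qed

end

lemma small_tail:
  assumes "summable (\<lambda>i. a (Suc i) powr \<gamma>)" "0 < \<epsilon>"
  obtains n where "1 \<le> n" "(\<Sum>k. a (Suc (k + n)) powr \<gamma>) < \<epsilon>"
proof -
  obtain N where "\<forall>n\<ge>N. norm (\<Sum>k. a (Suc (k + n)) powr \<gamma>) < \<epsilon>"
    using suminf_exist_split[OF assms(2,1)] by blast
  then have "norm (\<Sum>k. a (Suc (k + max 1 N)) powr \<gamma>) < \<epsilon>" by (metis max.cobounded2)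
  with that[of "max 1 N"] show ?thesis by simp
qed

section \<open>Compactness and the points added by the completion\<close>

text \<open>
  With \<open>\<gamma> = 1\<close> the radii are at most the total length of the branches of index above \<open>n\<close>, so the compact
  \<open>n\<close>-th tree is arbitrarily dense in \<open>T\<close>.
\<close>
lemma compact_completion:
  assumes "summable (\<lambda>i. a (Suc i))"
  shows "compact T"
  unfolding compact_eq_totally_bounded
proof (intro conjI allI impI)
  show "complete T" using completion by (simp add: is_completion_def)
next
  fix \<epsilon> :: real assume \<epsilon>: "0 < \<epsilon>"
  have "summable (\<lambda>i. a (Suc i) powr 1)" using assms pos by (simp add: less_imp_le)
  note sum1 = this
  from \<epsilon> have "0 < \<epsilon> / 2" by simp
  then obtain n where n: "1 \<le> n" "(\<Sum>k. a (Suc (k + n)) powr 1) < \<epsilon> / 2"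
    using small_tail[OF sum1] by blast
  obtain K where K: "finite K" "e ` tree a n \<subseteq> (\<Union>x\<in>K. ball x (\<epsilon> / 2))"
    using compact_image_tree[of n] \<epsilon> unfolding compact_eq_totally_bounded by (meson half_gt_zero)
  have "T \<subseteq> (\<Union>x\<in>K. ball x \<epsilon>)"
  proof
    fix x assume x: "x \<in> T"
    have "\<exists>y\<in>e ` tree a n. dist y x < \<epsilon> / 2"
    proof (cases "x \<in> e ` tree a n")
      case True
      then show ?thesis using \<epsilon> by (intro bexI[of _ x]) auto
    next
      case False
      then obtain i where i: "g (i - 1) \<in> tree a n"
        "dist (e (g (i - 1))) x \<le> bush_weight 1 n i powr (1 / 1)"
        using completion_subset[of 1 n] sum1 n x by auto
      moreover have "bush_weight 1 n i powr (1 / 1) < \<epsilon> / 2"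
        using bush_weight_le_tail[of 1 n i] bush_weight_nonneg[of 1 n i] sum1 n by simp
      ultimately show ?thesis by (intro bexI[of _ "e (g (i - 1))"]) auto
    qed
    then obtain y where y: "y \<in> e ` tree a n" "dist y x < \<epsilon> / 2" by blast
    then obtain z where z: "z \<in> K" "dist z y < \<epsilon> / 2" using K by auto
    have "dist z x < \<epsilon>" using dist_triangle[of z x y] y z by simp
    with z show "x \<in> (\<Union>x\<in>K. ball x \<epsilon>)" by auto
  qed
  with K show "\<exists>K. finite K \<and> T \<subseteq> (\<Union>x\<in>K. ball x \<epsilon>)" by blast
qed

text \<open>
  The points added by the completion lie outside every finite stage, hence in the balls around the
  bushes.  The \<open>\<gamma>\<close>-th powers of the diameters add up to at most \<open>2 powr \<gamma>\<close> times the tail of the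
  series, which is small for large \<open>n\<close>.
\<close>
lemma hausdorff_null_new_points:
  assumes \<gamma>: "0 < \<gamma>" "\<gamma> \<le> 1" and sum: "summable (\<lambda>i. a (Suc i) powr \<gamma>)"
  shows "hausdorff_measure \<gamma> (T - e ` tree_union a) = 0"
  unfolding hausdorff_measure_eq_0_iff[OF \<gamma>(1)]
proof (intro allI impI)
  fix \<epsilon> :: real assume "0 < \<epsilon>"
  then have "0 < \<epsilon> / 2 powr \<gamma>" by simp
  then obtain n where n: "1 \<le> n" "(\<Sum>k. a (Suc (k + n)) powr \<gamma>) < \<epsilon> / 2 powr \<gamma>"
    using small_tail[OF sum] by blast
  note bush = bush_weight_nonneg[OF \<gamma> sum n(1)] suminf_bush_weight[OF \<gamma> sum n(1)]
  define U where "U i = cball (e (g (i - 1))) (bush_weight \<gamma> n i powr (1 / \<gamma>))" for i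
  have "T - e ` tree_union a \<subseteq> (\<Union>i. U i)"
    using completion_subset[OF \<gamma> sum n(1)] tree_subset_union[of n] unfolding U_def by blast
  moreover have "bounded (U i)" for i by (simp add: U_def)
  moreover have "(\<Sum>i. ennreal (diameter (U i) powr \<gamma>)) \<le> ennreal \<epsilon>"
  proof -
    have "diameter (U i) powr \<gamma> \<le> 2 powr \<gamma> * bush_weight \<gamma> n i" for i
    proof -
      have "diameter (U i) \<le> 2 * bush_weight \<gamma> n i powr (1 / \<gamma>)"
      proof (rule diameter_le_metric)
        fix x y assume "x \<in> U i" "y \<in> U i"
        then show "dist x y \<le> 2 * bush_weight \<gamma> n i powr (1 / \<gamma>)"
          using dist_triangle3[of x y "e (g (i - 1))"] by (simp add: U_def)
      qed simp
      then have "diameter (U i) powr \<gamma> \<le> (2 * bush_weight \<gamma> n i powr (1 / \<gamma>)) powr \<gamma>"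
        using \<gamma> by (intro powr_mono2 diameter_ge_0) (auto simp: U_def)
      also have "\<dots> = 2 powr \<gamma> * bush_weight \<gamma> n i"
        using \<gamma> bush(1) by (simp add: powr_mult powr_powr)
      finally show ?thesis .
    qed
    then have "(\<Sum>i. ennreal (diameter (U i) powr \<gamma>)) \<le> (\<Sum>i. ennreal (2 powr \<gamma>) * ennreal (bush_weight \<gamma> n i))"
      using bush(1) by (intro suminf_le summableI) (simp add: ennreal_leI flip: ennreal_mult)
    also have "\<dots> = ennreal (2 powr \<gamma>) * ennreal (\<Sum>k. a (Suc (k + n)) powr \<gamma>)"
      by (simp only: ennreal_suminf_cmult bush(2))
    also have "\<dots> = ennreal (2 powr \<gamma> * (\<Sum>k. a (Suc (k + n)) powr \<gamma>))"
      by (simp add: ennreal_mult')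
    also have "\<dots> \<le> ennreal \<epsilon>"
      using n(2) by (intro ennreal_leI) (simp add: field_simps)
    finally show ?thesis .
  qed
  ultimately show "\<exists>U. T - e ` tree_union a \<subseteq> (\<Union>i. U i) \<and> (\<forall>i. bounded (U i)) \<and>
      (\<Sum>i. ennreal (diameter (U i) powr \<gamma>)) \<le> ennreal \<epsilon>"
    by blast
qed

end

section \<open>Leaves and Hausdorff dimension\<close>

text \<open>
  One side of the separation of the tree at the point \<open>(i, t)\<close>: the higher part of branch \<open>i\<close> and
  whatever is grafted on it, directly or through further branches.  Branches glued at \<open>(i, t)\<close>
  itself are put on the other side.  Heights are not cut off at the branch lengths, because only the
  trace of this set on the tree matters.
\<close>
inductive_set beyond :: "(nat \<Rightarrow> tree_point) \<Rightarrow> nat \<Rightarrow> real \<Rightarrow> tree_point set"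
  for g i t where
  above: "t < s \<Longrightarrow> (i, s) \<in> beyond g i t"
| graft: "i \<le> n \<Longrightarrow> g n \<in> beyond g i t \<Longrightarrow> (Suc n, s) \<in> beyond g i t"

lemma beyond_branch_ge: "u \<in> beyond g i t \<Longrightarrow> i \<le> fst u"
  by (induction rule: beyond.induct) auto

lemma beyond_same_branch_iff: "(i, s) \<in> beyond g i t \<longleftrightarrow> t < s"
  by (auto intro: beyond.above elim: beyond.cases)

lemma beyond_later_branch_iff: "i \<le> n \<Longrightarrow> (Suc n, s) \<in> beyond g i t \<longleftrightarrow> g n \<in> beyond g i t"
  by (auto intro: beyond.graft elim: beyond.cases)

text \<open>
  Every path that leaves the part beyond \<open>(i, t)\<close> runs through \<open>(i, t)\<close>.  Adding a branch preserves
  this, because all of it lies on the same side as its grafting point.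
\<close>
lemma tree_dist_beyond:
  assumes g: "grafting_points a g"
  shows "\<lbrakk>(i, t) \<in> tree a n; u \<in> tree a n; v \<in> tree a n; u \<in> beyond g i t; v \<notin> beyond g i t\<rbrakk> \<Longrightarrow>
    tree_dist g n u v = tree_dist g n u (i, t) + tree_dist g n (i, t) v"
proof (induction n arbitrary: u v)
  case (Suc n)
  show ?case
  proof (cases "i = Suc n")
    case True
    then obtain s where u: "u = (i, s)" "t < s"
      using Suc.prems beyond_branch_ge[OF Suc.prems(4)] beyond_same_branch_iff
        tree_branch[OF Suc.prems(2)] by (cases u) auto
    have "0 \<le> t" using tree_branch[OF Suc.prems(1)] by simp
    from g Suc.prems(3) show ?thesis
    proof (cases rule: tree_Suc_cases)
      case 1
      with u True \<open>0 \<le> t\<close> show ?thesis by simp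
    next
      case (2 r)
      with Suc.prems(5) True have "r \<le> t" by (simp add: beyond_same_branch_iff)
      with 2 u True show ?thesis by simp
    qed
  next
    case False
    with Suc.prems(1) have x: "(i, t) \<in> tree a n" "i \<le> n" by (auto simp: mem_tree_iff)
    note later = beyond_later_branch_iff[OF x(2)]
    from g Suc.prems(2) show ?thesis
    proof (cases rule: tree_Suc_cases)
      case u: 1
      from g Suc.prems(3) show ?thesis
      proof (cases rule: tree_Suc_cases)
        case 1
        with u x Suc.IH[of u v] Suc.prems False show ?thesis by simp
      next
        case v: (2 r)
        with Suc.prems(5) later have "g n \<notin> beyond g i t" by simp
        with u v x Suc.IH[of u "g n"] Suc.prems False show ?thesis by simp
      qed
    next
      case u: (2 s)
      with Suc.prems(4) later have gn: "g n \<in> beyond g i t" by simp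
      from g Suc.prems(3) show ?thesis
      proof (cases rule: tree_Suc_cases)
        case 1
        with u x gn Suc.IH[of "g n" v] Suc.prems False show ?thesis by simp
      next
        case (2 r)
        with Suc.prems(5) later gn show ?thesis by simp
      qed
    qed
  qed
qed simp

context grafted_tree
begin

text \<open>
  The point separates \<open>T\<close> into the closures of what is beyond it and of the rest.  A common limit of
  points \<open>u\<close> of one kind and \<open>v\<close> of the other must be the point itself, since \<open>u\<close> is at least as
  close to it as to \<open>v\<close>.
\<close>
lemma inner_branch_point_not_leaf:
  assumes i: "1 \<le> i" and t: "0 < t" "t < a i"
  shows "e (i, t) \<notin> leaves T"
proof
  let ?x = "e (i, t)" and ?U = "tree_union a" and ?Up = "beyond g i t"
  have tree_i: "(i, t) \<in> tree a i" "(i, a i) \<in> tree a i" "(i, t / 2) \<in> tree a i"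
    using i t by (auto simp: mem_tree_iff)
  assume "?x \<in> leaves T"
  then have conn: "connected (T - {?x})" by (simp add: leaves_def)
  define A where "A = closure (e ` (?U \<inter> ?Up))"
  define B where "B = closure (e ` (?U - ?Up))"
  have between: "dist (e u) ?x \<le> dist (e u) (e v)" if "u \<in> ?U \<inter> ?Up" "v \<in> ?U - ?Up" for u v
  proof -
    from that obtain k l where "u \<in> tree a k" "v \<in> tree a l" by (auto simp: tree_union_def)
    then have *: "(i, t) \<in> tree a (i + k + l)" "u \<in> tree a (i + k + l)" "v \<in> tree a (i + k + l)"
      using tree_i(1) tree_mono[THEN subsetD] by (meson le_add1 le_add2 order_trans)+
    have "dist (e u) (e v) = dist (e u) ?x + dist ?x (e v)"
      unfolding dist_e[OF *(2,3)] dist_e[OF *(2,1)] dist_e[OF *(1,3)]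
      using that by (intro tree_dist_beyond[OF grafting *]) auto
    then show ?thesis by simp
  qed
  have "z = ?x" if "z \<in> A" "z \<in> B" for z
  proof (rule ccontr)
    assume "z \<noteq> ?x"
    then have \<delta>: "0 < dist z ?x / 3" by simp
    obtain u where u: "u \<in> ?U \<inter> ?Up" "dist (e u) z < dist z ?x / 3"
      using \<open>z \<in> A\<close> \<delta> unfolding A_def closure_approachable by blast
    obtain v where v: "v \<in> ?U - ?Up" "dist (e v) z < dist z ?x / 3"
      using \<open>z \<in> B\<close> \<delta> unfolding B_def closure_approachable by blast
    have "dist z ?x \<le> dist (e u) z + dist (e u) (e v)"
      using dist_triangle[of z ?x "e u"] between[OF u(1) v(1)] by (simp add: dist_commute)
    also have "\<dots> \<le> dist (e u) z + (dist (e u) z + dist (e v) z)"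
      by (intro add_left_mono dist_triangle2)
    finally show False using u(2) v(2) by simp
  qed
  then have "A \<inter> B \<inter> (T - {?x}) = {}" by blast
  moreover have "T - {?x} \<subseteq> A \<union> B"
  proof -
    have "T \<subseteq> closure (e ` ?U)" using completion by (simp add: is_completion_def)
    also have "e ` ?U = e ` (?U \<inter> ?Up) \<union> e ` (?U - ?Up)" by blast
    finally show ?thesis unfolding A_def B_def by (auto simp flip: closure_Un)
  qed
  moreover have "e (i, a i) \<in> A \<inter> (T - {?x})"
  proof -
    have "(i, a i) \<in> ?U \<inter> ?Up"
      using tree_i tree_subset_union t beyond.above by blast
    then have "e (i, a i) \<in> A" unfolding A_def by (intro closure_subset[THEN subsetD] imageI)
    moreover have "e (i, a i) \<noteq> ?x"
      using dist_same_branch[OF tree_i(2,1)] t by auto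
    ultimately show ?thesis using image_tree_subset[of i] tree_i by auto
  qed
  moreover have "e (i, t / 2) \<in> B \<inter> (T - {?x})"
  proof -
    have "(i, t / 2) \<in> ?U - ?Up"
      using tree_i tree_subset_union t by (auto simp: beyond_same_branch_iff)
    then have "e (i, t / 2) \<in> B" unfolding B_def by (intro closure_subset[THEN subsetD] imageI)
    moreover have "e (i, t / 2) \<noteq> ?x"
      using dist_same_branch[OF tree_i(3,1)] t by auto
    ultimately show ?thesis using image_tree_subset[of i] tree_i by auto
  qed
  moreover have "closed A" "closed B" by (simp_all add: A_def B_def)
  ultimately show False using conn unfolding connected_closed by blast
qed

text \<open>
  The only end at height \<open>0\<close> is the start \<open>(1, 0)\<close> of the first branch: the glued end of a later
  branch is a point of an earlier one.
\<close>
lemma leaves_subset: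
  "leaves T \<subseteq> insert (e (1, 0)) (range (\<lambda>i. e (i, a i))) \<union> (T - e ` tree_union a)"
proof
  fix x assume x: "x \<in> leaves T"
  show "x \<in> insert (e (1, 0)) (range (\<lambda>i. e (i, a i))) \<union> (T - e ` tree_union a)"
  proof (cases "x \<in> e ` tree_union a")
    case True
    then obtain i t n where it: "x = e (i, t)" "(i, t) \<in> tree a n"
      by (auto simp: tree_union_def)
    then have "1 \<le> i" "t \<le> a i" "t = 0 \<Longrightarrow> i = 1" "0 \<le> t"
      by (auto simp: mem_tree_iff split: if_splits)
    moreover have "\<not> (0 < t \<and> t < a i)"
      using inner_branch_point_not_leaf[of i t] x it \<open>1 \<le> i\<close> by blast
    ultimately have "t = a i \<or> (i, t) = (1, 0)" by fastforce
    with it show ?thesis by auto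
  next
    case False
    with x show ?thesis by (auto simp: leaves_def)
  qed
qed

lemma hausdorff_null_leaves:
  assumes "0 < \<gamma>" "\<gamma> \<le> 1" "summable (\<lambda>i. a (Suc i) powr \<gamma>)"
  shows "hausdorff_measure \<gamma> (leaves T) = 0"
  using assms
  by (intro hausdorff_null_mono[OF _ _ leaves_subset] hausdorff_null_Un hausdorff_null_countable
      hausdorff_null_new_points) auto

text \<open>
  For exponents above \<open>1\<close>, the countably many branches and the points added by the completion are
  null.  A null exponent of at most \<open>1\<close> would make \<open>1\<close> a null exponent as well, which the first branch
  excludes.
\<close>
lemma hausdorff_dim_completion:
  assumes sum: "summable (\<lambda>i. a (Suc i))"
  shows "hausdorff_dim T = 1"
proof (rule antisym)
  have sum1: "summable (\<lambda>i. a (Suc i) powr 1)" using sum pos by (simp add: less_imp_le)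
  have "hausdorff_dim T \<le> ereal s" if s: "1 < s" for s
  proof (rule hausdorff_dim_le)
    show "0 < s" using s by simp
    have "e ` tree_union a = (\<Union>n. branch (Suc n) ` {0..a (Suc n)})"
    proof -
      have "e ` tree_union a = (\<Union>n\<in>{1..}. \<Union>j\<in>{1..n}. branch j ` {0..a j})"
        by (simp only: tree_union_def image_UN image_tree_eq)
      also have "\<dots> = (\<Union>j\<in>{1..}. branch j ` {0..a j})" by fastforce
      also have "{1..} = range Suc" by (auto simp: image_iff Suc_le_eq gr0_conv_Suc)
      finally show ?thesis by simp
    qed
    moreover have "hausdorff_measure s (branch (Suc n) ` {0..a (Suc n)}) = 0" for n
      using s pos[of "Suc n"] dist_branch[of "Suc n"] by (intro hausdorff_null_curve) auto
    ultimately have "hausdorff_measure s (e ` tree_union a) = 0"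
      using \<open>0 < s\<close> by (simp only: hausdorff_null_UN)
    moreover have "hausdorff_measure s (T - e ` tree_union a) = 0"
      by (rule hausdorff_null_exponent_mono[OF _ _ hausdorff_null_new_points[OF _ _ sum1]])
        (use s in auto)
    ultimately have "hausdorff_measure s (e ` tree_union a \<union> (T - e ` tree_union a)) = 0"
      by (rule hausdorff_null_Un[OF \<open>0 < s\<close>])
    then show "hausdorff_measure s T = 0"
      by (rule hausdorff_null_mono[OF \<open>0 < s\<close>]) auto
  qed
  note le = this
  show "hausdorff_dim T \<le> 1"
  proof (rule dense_ge)
    fix x :: ereal assume "1 < x"
    then show "hausdorff_dim T \<le> x" using le by (cases x) auto
  qed
next
  have seg: "branch 1 ` {0..a 1} \<subseteq> T"
    using image_tree_eq[of 1] image_tree_subset[of 1] by simp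
  show "1 \<le> hausdorff_dim T"
    unfolding hausdorff_dim_def
  proof (rule INF_greatest)
    fix s assume "s \<in> {s. 0 < s \<and> hausdorff_measure s T = 0}"
    then have s: "0 < s" "hausdorff_measure s T = 0" by auto
    have "hausdorff_measure 1 (branch 1 ` {0..a 1}) \<noteq> 0"
      by (rule hausdorff_segment_not_null) (use pos dist_branch in auto)
    then have "hausdorff_measure 1 T \<noteq> 0"
      using hausdorff_null_mono[OF zero_less_one _ seg] by blast
    then have "\<not> s \<le> 1" using s hausdorff_null_exponent_mono[of s 1 T] by blast
    then show "1 \<le> ereal s" by simp
  qed
qed

end

theorem proposition16:
  fixes a :: "nat \<Rightarrow> real"
    and g :: "nat \<Rightarrow> tree_point"
    and e :: "tree_point \<Rightarrow> 'b::metric_space"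
    and T :: "'b set"
  assumes "\<And>i. i \<ge> 1 \<Longrightarrow> 0 < a i"
    and "grafting_points a g"
    and "is_completion (tree_union a) (tree_union_dist g) e T"
    and "summable (\<lambda>i. a (Suc i))"
  shows "compact T \<and> hausdorff_dim T = 1 \<and>
    (\<forall>\<gamma>::real. summable (\<lambda>i. a (Suc i) powr \<gamma>) \<longrightarrow> hausdorff_dim (leaves T) \<le> ereal \<gamma>)"
proof (intro conjI allI impI)
  interpret grafted_tree a g e T
    using assms by unfold_locales
  show "compact T" by (rule compact_completion[OF assms(4)])
  show dim: "hausdorff_dim T = 1" by (rule hausdorff_dim_completion[OF assms(4)])
  fix \<gamma> :: real assume sum: "summable (\<lambda>i. a (Suc i) powr \<gamma>)"
  show "hausdorff_dim (leaves T) \<le> ereal \<gamma>"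
  proof (cases "\<gamma> \<le> 1")
    case True
    \<comment> \<open>For \<open>\<gamma> \<le> 0\<close> the terms \<open>a (Suc i) powr \<gamma>\<close> are at least \<open>1\<close> once the lengths are below \<open>1\<close>.\<close>
    have "0 < \<gamma>"
    proof (rule ccontr)
      assume "\<not> 0 < \<gamma>"
      have "\<forall>\<^sub>F i in sequentially. a (Suc i) < 1"
        by (rule order_tendstoD(2)[OF summable_LIMSEQ_zero[OF assms(4)]]) simp
      moreover have "\<forall>\<^sub>F i in sequentially. a (Suc i) powr \<gamma> < 1"
        by (rule order_tendstoD(2)[OF summable_LIMSEQ_zero[OF sum]]) simp
      ultimately have "\<forall>\<^sub>F i in sequentially. False"
      proof eventually_elim
        case (elim i)
        have "1 powr \<gamma> \<le> a (Suc i) powr \<gamma>"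
          using elim \<open>\<not> 0 < \<gamma>\<close> pos[of "Suc i"] by (intro powr_mono2') auto
        with elim show False by simp
      qed
      then show False by simp
    qed
    with True sum show ?thesis by (intro hausdorff_dim_le hausdorff_null_leaves)
  next
    case False
    have "hausdorff_dim (leaves T) \<le> hausdorff_dim T"
      by (rule hausdorff_dim_mono) (auto simp: leaves_def)
    with dim False show ?thesis by (simp add: one_ereal_def order_trans[of _ "ereal 1"])
  qed
qed

end
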